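(* Let $(M_1,F_1)$ and $(M_2,F_2)$ be two Finslerian manifolds, and let $f_k:M_k\to(0,\infty)$, $k\in\{1,2\}$, be smooth functions. If ${}_{f_2}F_1\star_{f_1}F_2$ is a convolution Finslerian metric on the manifold $M_1\times M_2$, then one of the following assertions holds: (1) the gradient of one of the functions $f_k$ is orthogonal to any tangent vector on $M_1\times M_2$; (2) one of the $f_k$ is a nonzero constant. In this last case, when one of the $f_k\equiv 1$, the convolution Finslerian metric ${}_{f_2}F_1\star_{f_1}F_2$ reduces to a Finslerian warped product metric.
   Context: A Finslerian metric on a manifold $M$ is a function $F:TM\to[0,\infty)$ that is $C^\infty$ on the slit tangent bundle $\mathring{T}M$, satisfies $F(x,cy)=cF(x,y)$ for all $c>0$, and has Hessian matrix $g_{ij}(x,y)=\frac12\frac{\partial^2F^2}{\partial y^i\partial y^j}(x,y)$ positive-definite at every point of $\mathring{T}M$. For a product $M=M_1\times M_2$ the slit tangent bundle is $\mathring{T}M=\{(x_1,x_2,y_1,y_2)\in TM: y_1\neq 0,\ y_2\neq 0\}$, with $x_k\in M_k$, $y_k\in T_{x_k}M_k$; on each factor $\mathring{T}M_k$ is $TM_k$ without the zero section. Gradient: for a smooth function $u$ on a Finslerian manifold with Hessian matrix $g$, $\nabla u$ is the section of $\pi^*TM$ (with $\pi:\mathring{T}M\to M$ the projection) with $g_{(x,y)}(\nabla u_{(x,y)},\xi_{(x,y)})=du(\xi_{(x,y)})$ for every section $\xi$ of $\pi^*TM$; locally $\nabla u=g^{ij}(x,y)\frac{\partial u}{\partial x^i}\frac{\partial}{\partial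 x^j}$. Thus $\nabla f_k$ being orthogonal to a tangent vector $v$ on $M_1\times M_2$ means orthogonality of $\nabla f_k$ to (the $M_k$-component of) $v$. Convolution: let $\dim M_1=n_1$, $\dim M_2=n_2$, $n=n_1+n_2$. The Finslerian convolution (function) of $F_1$ and $F_2$ via $f_1,f_2$ is $F={}_{f_2}F_1\star_{f_1}F_2:T(M_1\times M_2)\to(0,\infty)$ given by $$F^2=f_2^2F_1^2+f_1^2F_2^2+\tfrac12 f_1f_2\,\frac{\partial F_1^2}{\partial y^i}\frac{\partial F_2^2}{\partial y^j}(\nabla f_1)^i(\nabla f_2)^j,$$ where $F_k,f_k$ are pulled back to $M_1\times M_2$ by the projections, $\nabla f_k$ is the gradient with respect to $F_k$, and repeated indices are summed. Associated matrix: in local coordinates $(x_1^1,\dots,x_1^{n_1},x_2^{n_1+1},\dots,x_2^n)$ the matrix associated with $F$ is $$\begin{pmatrix} f_2^2\,(g_{1\alpha\beta}) & 2f_1f_2\left(\frac{\partial f_1}{\partial x_1^\alpha}\frac{\partial f_2}{\partial x_2^\nu}\right)\\ (0) & f_1^2\,(g_{2\mu\nu})\end{pmatrix},\qquad \alpha,\beta\in\{1,\dots,n_1\},\ \mu,\nu\in\{n_1+1,\dots,n\},$$ where $g_1,g_2$ are the Hessian matrices of $F_1,F_2$. ${}_{f_2}F_1\star_{f_1}F_2$ is called a convolution Finslerian metric when this matrix is positive-definite and symmetric on $\mathring{T}(M_1\times M_2)$ (so that it defines a Finslerian metric on $M_1\times M_2$). A Finslerian warped product metric on $M_1\times M_2$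 is one of the form $\sqrt{F_1^2+f_1^2F_2^2}$ (or, with the roles of the factors exchanged, $\sqrt{f_2^2F_1^2+F_2^2}$). *)

theory Defs
  imports "HOL-Analysis.Analysis"
begin

section \<open>Smooth maps between Euclidean spaces\<close>

text \<open>Meant for open sets. On finite-dimensional spaces continuity of all the iterated directional
  derivatives is continuity of all the partial derivatives.\<close>

fun Ck_on :: "nat \<Rightarrow> 'a::euclidean_space set \<Rightarrow> ('a \<Rightarrow> 'b::real_normed_vector) \<Rightarrow> bool" where
  "Ck_on 0 S f \<longleftrightarrow> continuous_on S f"
| "Ck_on (Suc k) S f \<longleftrightarrow>
     (\<forall>x\<in>S. f differentiable (at x)) \<and> (\<forall>v. Ck_on k S (\<lambda>x. frechet_derivative f (at x) v))"

definition smooth_on :: "'a::euclidean_space set \<Rightarrow> ('a \<Rightarrow> 'b::real_normed_vector) \<Rightarrow> bool" where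
  "smooth_on S f \<longleftrightarrow> (\<forall>k. Ck_on k S f)"

definition partial_deriv :: "'n \<Rightarrow> (real^'n::finite \<Rightarrow> real) \<Rightarrow> real^'n \<Rightarrow> real" where
  "partial_deriv i h v = frechet_derivative h (at v) (axis i 1)"

definition positive_definite :: "real^'n^'n::finite \<Rightarrow> bool" where
  "positive_definite G \<longleftrightarrow> (\<forall>v. v \<noteq> 0 \<longrightarrow> 0 < v \<bullet> (G *v v))"

section \<open>Smooth manifolds and their tangent spaces\<close>

text \<open>A chart is a pair of its domain and its coordinate map; the values of the coordinate map
  outside the domain are irrelevant.\<close>

type_synonym ('a, 'n) chart = "'a set \<times> ('a \<Rightarrow> real^'n)"

definition transition :: "('a, 'n::finite) chart \<Rightarrow> ('a, 'n) chart \<Rightarrow> real^'n \<Rightarrow> real^'n" where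
  "transition c d = snd d \<circ> inv_into (fst c) (snd c)"

text \<open>\<open>A\<close> is a smooth atlas (not necessarily maximal) on the topological space \<open>X\<close>.\<close>

locale smooth_manifold =
  fixes X :: "'a topology" and A :: "('a, 'n::finite) chart set"
  assumes Hausdorff: "Hausdorff_space X"
    and second_countable: "second_countable X"
    and chart_domain_open: "\<And>c. c \<in> A \<Longrightarrow> openin X (fst c)"
    and chart_image_open: "\<And>c. c \<in> A \<Longrightarrow> open (snd c ` fst c)"
    and chart_homeomorphic: "\<And>c. c \<in> A \<Longrightarrow>
          homeomorphic_map (subtopology X (fst c)) (top_of_set (snd c ` fst c)) (snd c)"
    and charts_cover: "(\<Union>c\<in>A. fst c) = topspace X"
    and charts_compatible: "\<And>c d. c \<in> A \<Longrightarrow> d \<in> A \<Longrightarrow>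
          smooth_on (snd c ` (fst c \<inter> fst d)) (transition c d)"

definition charts_at :: "('a, 'n::finite) chart set \<Rightarrow> 'a \<Rightarrow> ('a, 'n) chart set" where
  "charts_at A x = {c \<in> A. x \<in> fst c}"

text \<open>A tangent vector at \<open>x\<close> assigns to every chart around \<open>x\<close> its components in that chart,
  subject to the transformation rule of contravariant vectors; it is \<open>0\<close> (a dummy value) on
  everything that is not a chart around \<open>x\<close>. The linear structure is pointwise, in particular
  the zero vector is the zero function.\<close>

type_synonym ('a, 'n) tangent = "('a, 'n) chart \<Rightarrow> real^'n"

definition transition_deriv ::
    "('a, 'n::finite) chart \<Rightarrow> ('a, 'n) chart \<Rightarrow> 'a \<Rightarrow> real^'n \<Rightarrow> real^'n" where
  "transition_deriv c d x = frechet_derivative (transition c d) (at (snd c x))"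

definition tangent_space :: "('a, 'n::finite) chart set \<Rightarrow> 'a \<Rightarrow> ('a, 'n) tangent set" where
  "tangent_space A x = {\<xi>.
     (\<forall>c \<in> charts_at A x. \<forall>d \<in> charts_at A x. \<xi> d = transition_deriv c d x (\<xi> c)) \<and>
     (\<forall>d. d \<notin> charts_at A x \<longrightarrow> \<xi> d = 0)}"

text \<open>The tangent vector at \<open>x\<close> with components \<open>v\<close> in the chart \<open>c\<close>.\<close>

definition tangent_of_coords ::
    "('a, 'n::finite) chart set \<Rightarrow> ('a, 'n) chart \<Rightarrow> 'a \<Rightarrow> real^'n \<Rightarrow> ('a, 'n) tangent" where
  "tangent_of_coords A c x v = (\<lambda>d. if d \<in> charts_at A x then transition_deriv c d x v else 0)"

definition slit_tangent_bundle ::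
    "'a topology \<Rightarrow> ('a, 'n::finite) chart set \<Rightarrow> ('a \<times> ('a, 'n) tangent) set" where
  "slit_tangent_bundle X A =
     {(x, y). x \<in> topspace X \<and> y \<in> tangent_space A x \<and> y \<noteq> (\<lambda>_. 0)}"

definition smooth_function :: "('a, 'n::finite) chart set \<Rightarrow> ('a \<Rightarrow> real) \<Rightarrow> bool" where
  "smooth_function A f \<longleftrightarrow> (\<forall>c\<in>A. smooth_on (snd c ` fst c) (f \<circ> inv_into (fst c) (snd c)))"

section \<open>Finslerian manifolds\<close>

text \<open>The partial derivative \<open>\<partial>F\<^sup>2/\<partial>y\<^sup>i\<close> and the Hessian matrix \<open>(g\<^sub>i\<^sub>j)\<close> at \<open>(x, y)\<close> with respect to
  the chart \<open>c\<close>.\<close>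

definition fibre_deriv_sq ::
    "('a, 'n::finite) chart set \<Rightarrow> ('a \<Rightarrow> ('a, 'n) tangent \<Rightarrow> real) \<Rightarrow> ('a, 'n) chart \<Rightarrow>
     'a \<Rightarrow> ('a, 'n) tangent \<Rightarrow> 'n \<Rightarrow> real" where
  "fibre_deriv_sq A F c x y i =
     partial_deriv i (\<lambda>v. (F x (tangent_of_coords A c x v))\<^sup>2) (y c)"

definition hessian_matrix ::
    "('a, 'n::finite) chart set \<Rightarrow> ('a \<Rightarrow> ('a, 'n) tangent \<Rightarrow> real) \<Rightarrow> ('a, 'n) chart \<Rightarrow>
     'a \<Rightarrow> ('a, 'n) tangent \<Rightarrow> real^'n^'n" where
  "hessian_matrix A F c x y = (\<chi> i j.
     1/2 * partial_deriv i (partial_deriv j (\<lambda>v. (F x (tangent_of_coords A c x v))\<^sup>2)) (y c))"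

locale finsler_manifold = smooth_manifold X A
  for X :: "'a topology" and A :: "('a, 'n::finite) chart set" +
  fixes F :: "'a \<Rightarrow> ('a, 'n) tangent \<Rightarrow> real"
  assumes F_nonneg: "\<And>x y. x \<in> topspace X \<Longrightarrow> y \<in> tangent_space A x \<Longrightarrow> 0 \<le> F x y"
    and F_smooth: "\<And>c. c \<in> A \<Longrightarrow> smooth_on (snd c ` fst c \<times> (- {0}))
          (\<lambda>(u, v). let x = inv_into (fst c) (snd c) u in F x (tangent_of_coords A c x v))"
    and F_homogeneous: "\<And>x y r. x \<in> topspace X \<Longrightarrow> y \<in> tangent_space A x \<Longrightarrow> 0 < r \<Longrightarrow>
          F x (\<lambda>c. r *\<^sub>R y c) = r * F x y"
    and hessian_positive_definite: "\<And>x y c. (x, y) \<in> slit_tangent_bundle X A \<Longrightarrow>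
          c \<in> charts_at A x \<Longrightarrow> positive_definite (hessian_matrix A F c x y)"

text \<open>The tensors below are written in components with respect to an arbitrarily chosen chart
  around \<open>x\<close>; their values do not depend on that choice, by the chain rule.\<close>

definition chart_at :: "('a, 'n::finite) chart set \<Rightarrow> 'a \<Rightarrow> ('a, 'n) chart" where
  "chart_at A x = (SOME c. c \<in> charts_at A x)"

definition fundamental_form ::
    "('a, 'n::finite) chart set \<Rightarrow> ('a \<Rightarrow> ('a, 'n) tangent \<Rightarrow> real) \<Rightarrow> 'a \<Rightarrow> ('a, 'n) tangent \<Rightarrow>
     ('a, 'n) tangent \<Rightarrow> ('a, 'n) tangent \<Rightarrow> real" where
  "fundamental_form A F x y \<xi> \<eta> = (let c = chart_at A x in
     \<Sum>i\<in>UNIV. \<Sum>j\<in>UNIV. hessian_matrix A F c x y $ i $ j * \<xi> c $ i * \<eta> c $ j)"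

definition coord_deriv :: "('a \<Rightarrow> real) \<Rightarrow> ('a, 'n::finite) chart \<Rightarrow> 'a \<Rightarrow> 'n \<Rightarrow> real" where
  "coord_deriv f c x i = partial_deriv i (f \<circ> inv_into (fst c) (snd c)) (snd c x)"

definition differential ::
    "('a, 'n::finite) chart set \<Rightarrow> ('a \<Rightarrow> real) \<Rightarrow> 'a \<Rightarrow> ('a, 'n) tangent \<Rightarrow> real" where
  "differential A f x \<xi> = (let c = chart_at A x in \<Sum>i\<in>UNIV. coord_deriv f c x i * \<xi> c $ i)"

definition gradient ::
    "('a, 'n::finite) chart set \<Rightarrow> ('a \<Rightarrow> ('a, 'n) tangent \<Rightarrow> real) \<Rightarrow> ('a \<Rightarrow> real) \<Rightarrow>
     'a \<Rightarrow> ('a, 'n) tangent \<Rightarrow> ('a, 'n) tangent" where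
  "gradient A F f x y = (THE \<eta>. \<eta> \<in> tangent_space A x \<and>
     (\<forall>\<xi> \<in> tangent_space A x. fundamental_form A F x y \<eta> \<xi> = differential A f x \<xi>))"

section \<open>Convolutions and warped products\<close>

text \<open>Points of the product manifold are pairs, and the tangent space of the product at
  \<open>(x\<^sub>1, x\<^sub>2)\<close> is the product of the tangent spaces at \<open>x\<^sub>1\<close> and \<open>x\<^sub>2\<close>. As in the setting of
  convolutions, both components of a vector in the slit tangent bundle of the product are
  nonzero.\<close>

definition product_slit_tangent_bundle ::
    "'a topology \<Rightarrow> ('a, 'm::finite) chart set \<Rightarrow> 'b topology \<Rightarrow> ('b, 'n::finite) chart set \<Rightarrow>
     (('a \<times> 'b) \<times> (('a, 'm) tangent \<times> ('b, 'n) tangent)) set" where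
  "product_slit_tangent_bundle X1 A1 X2 A2 = {((x1, x2), (y1, y2)).
     (x1, y1) \<in> slit_tangent_bundle X1 A1 \<and> (x2, y2) \<in> slit_tangent_bundle X2 A2}"

fun convolution ::
    "('a, 'm::finite) chart set \<Rightarrow> ('a \<Rightarrow> ('a, 'm) tangent \<Rightarrow> real) \<Rightarrow> ('a \<Rightarrow> real) \<Rightarrow>
     ('b, 'n::finite) chart set \<Rightarrow> ('b \<Rightarrow> ('b, 'n) tangent \<Rightarrow> real) \<Rightarrow> ('b \<Rightarrow> real) \<Rightarrow>
     'a \<times> 'b \<Rightarrow> ('a, 'm) tangent \<times> ('b, 'n) tangent \<Rightarrow> real" where
  "convolution A1 F1 f1 A2 F2 f2 (x1, x2) (y1, y2) =
     (let c1 = chart_at A1 x1; c2 = chart_at A2 x2 in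
      sqrt ((f2 x2)\<^sup>2 * (F1 x1 y1)\<^sup>2 + (f1 x1)\<^sup>2 * (F2 x2 y2)\<^sup>2
        + 1/2 * f1 x1 * f2 x2 *
          (\<Sum>i\<in>UNIV. \<Sum>j\<in>UNIV. fibre_deriv_sq A1 F1 c1 x1 y1 i * fibre_deriv_sq A2 F2 c2 x2 y2 j
              * gradient A1 F1 f1 x1 y1 c1 $ i * gradient A2 F2 f2 x2 y2 c2 $ j)))"

text \<open>Rows and columns are indexed by the disjoint sum of the two coordinate index types.\<close>

fun associated_matrix ::
    "('a, 'm::finite) chart set \<Rightarrow> ('a \<Rightarrow> ('a, 'm) tangent \<Rightarrow> real) \<Rightarrow> ('a \<Rightarrow> real) \<Rightarrow>
     ('b, 'n::finite) chart set \<Rightarrow> ('b \<Rightarrow> ('b, 'n) tangent \<Rightarrow> real) \<Rightarrow> ('b \<Rightarrow> real) \<Rightarrow>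
     ('a, 'm) chart \<Rightarrow> ('b, 'n) chart \<Rightarrow>
     'a \<times> 'b \<Rightarrow> ('a, 'm) tangent \<times> ('b, 'n) tangent \<Rightarrow> real^('m + 'n)^('m + 'n)" where
  "associated_matrix A1 F1 f1 A2 F2 f2 c1 c2 (x1, x2) (y1, y2) = (\<chi> p q.
     case (p, q) of
       (Inl \<alpha>, Inl \<beta>) \<Rightarrow> (f2 x2)\<^sup>2 * hessian_matrix A1 F1 c1 x1 y1 $ \<alpha> $ \<beta>
     | (Inl \<alpha>, Inr \<nu>) \<Rightarrow> 2 * f1 x1 * f2 x2 * (coord_deriv f1 c1 x1 \<alpha> * coord_deriv f2 c2 x2 \<nu>)
     | (Inr \<mu>, Inl \<beta>) \<Rightarrow> 0
     | (Inr \<mu>, Inr \<nu>) \<Rightarrow> (f1 x1)\<^sup>2 * hessian_matrix A2 F2 c2 x2 y2 $ \<mu> $ \<nu>)"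

text \<open>The convolution of \<open>F1\<close> and \<open>F2\<close> via \<open>f1\<close> and \<open>f2\<close> is a convolution Finslerian metric.\<close>

definition is_convolution_metric ::
    "'a topology \<Rightarrow> ('a, 'm::finite) chart set \<Rightarrow> ('a \<Rightarrow> ('a, 'm) tangent \<Rightarrow> real) \<Rightarrow> ('a \<Rightarrow> real) \<Rightarrow>
     'b topology \<Rightarrow> ('b, 'n::finite) chart set \<Rightarrow> ('b \<Rightarrow> ('b, 'n) tangent \<Rightarrow> real) \<Rightarrow> ('b \<Rightarrow> real) \<Rightarrow>
     bool" where
  "is_convolution_metric X1 A1 F1 f1 X2 A2 F2 f2 \<longleftrightarrow>
     (\<forall>((x1, x2), (y1, y2)) \<in> product_slit_tangent_bundle X1 A1 X2 A2.
        \<forall>c1 \<in> charts_at A1 x1. \<forall>c2 \<in> charts_at A2 x2.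
          (let G = associated_matrix A1 F1 f1 A2 F2 f2 c1 c2 (x1, x2) (y1, y2)
           in transpose G = G \<and> positive_definite G))"

text \<open>The two forms of a Finslerian warped product metric; the factor that is warped is the
  second one and the first one, respectively.\<close>

fun warped_product_snd ::
    "('a \<Rightarrow> ('a, 'm::finite) tangent \<Rightarrow> real) \<Rightarrow> ('a \<Rightarrow> real) \<Rightarrow> ('b \<Rightarrow> ('b, 'n::finite) tangent \<Rightarrow> real) \<Rightarrow>
     'a \<times> 'b \<Rightarrow> ('a, 'm) tangent \<times> ('b, 'n) tangent \<Rightarrow> real" where
  "warped_product_snd F1 f1 F2 (x1, x2) (y1, y2) = sqrt ((F1 x1 y1)\<^sup>2 + (f1 x1)\<^sup>2 * (F2 x2 y2)\<^sup>2)"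

fun warped_product_fst ::
    "('a \<Rightarrow> ('a, 'm::finite) tangent \<Rightarrow> real) \<Rightarrow> ('b \<Rightarrow> ('b, 'n::finite) tangent \<Rightarrow> real) \<Rightarrow> ('b \<Rightarrow> real) \<Rightarrow>
     'a \<times> 'b \<Rightarrow> ('a, 'm) tangent \<times> ('b, 'n) tangent \<Rightarrow> real" where
  "warped_product_fst F1 F2 f2 (x1, x2) (y1, y2) = sqrt ((f2 x2)\<^sup>2 * (F1 x1 y1)\<^sup>2 + (F2 x2 y2)\<^sup>2)"

end

theory Submission
  imports Defs
begin

text \<open>
  Symmetry of the associated matrix is a very strong condition: one off-diagonal block is zero,
  so the other one, \<open>2 f\<^sub>1 f\<^sub>2 (\<partial>f\<^sub>1/\<partial>x\<^sub>1\<^sup>\<alpha>) (\<partial>f\<^sub>2/\<partial>x\<^sub>2\<^sup>\<nu>)\<close>, has to vanish as well. As \<open>f\<^sub>1\<close> and \<open>f\<^sub>2\<close>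
  are positive, at each pair of points every product of a partial derivative of \<open>f\<^sub>1\<close> with one of
  \<open>f\<^sub>2\<close> is zero. The two factors depend on independent points, so all the partial derivatives of one
  of the two functions vanish identically (lemma \<open>convolution_metric_imp_critical\<close>). Because the
  fundamental form is positive definite, the gradient of that function is then the zero vector
  (lemma \<open>gradient_eq_zero\<close>), which is orthogonal to everything. A function with vanishing
  differential is constant only on each connected component; orthogonality of the gradient
  holds on disconnected manifolds too, so it is always alternative (1) that is proved.

  The matrix is only considered at points of the slit tangent bundle, so to use it at arbitrary base
  points one needs a nonzero tangent vector over each of them. It comes from
  nonzero components in one chart; the transformation rule for the components in the other charts is
  the chain rule for the transition maps (lemma \<open>tangent_of_coords_in_tangent_space\<close>).

  The reduction to a warped product is the same vanishing of the gradient: if \<open>f\<^sub>k\<close> is the constant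
  \<open>1\<close>, then its gradient is zero and the mixed term of the convolution disappears.
\<close>

section \<open>Transition maps and tangent vectors\<close>

context smooth_manifold
begin

lemma chart_inj: "c \<in> A \<Longrightarrow> inj_on (snd c) (fst c)"
  using chart_homeomorphic[of c] chart_domain_open[of c] openin_subset[of X "fst c"]
  by (auto simp: homeomorphic_eq_everything_map Int_absorb1)

lemma chart_inv [simp]: "c \<in> A \<Longrightarrow> x \<in> fst c \<Longrightarrow> inv_into (fst c) (snd c) (snd c x) = x"
  by (simp add: chart_inj)

lemma chart_image_open_subset:
  assumes "c \<in> A" "openin X U" "U \<subseteq> fst c"
  shows "open (snd c ` U)"
proof -
  have "openin (subtopology X (fst c)) U"
    using assms by (simp add: openin_subset openin_open_subtopology chart_domain_open)
  then have "openin (top_of_set (snd c ` fst c)) (snd c ` U)"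
    using chart_homeomorphic[OF assms(1)] homeomorphic_imp_open_map open_map_def by blast
  then show ?thesis
    using chart_image_open[OF assms(1)] openin_open_trans by blast
qed

lemma transition_apply: "c \<in> A \<Longrightarrow> x \<in> fst c \<Longrightarrow> transition c d (snd c x) = snd d x"
  by (simp add: transition_def)

lemma transition_has_derivative:
  assumes "c \<in> charts_at A x" "d \<in> charts_at A x"
  shows "(transition c d has_derivative transition_deriv c d x) (at (snd c x))"
proof -
  have "Ck_on (Suc 0) (snd c ` (fst c \<inter> fst d)) (transition c d)"
    using assms charts_compatible unfolding smooth_on_def charts_at_def by blast
  then have "transition c d differentiable (at (snd c x))"
    using assms by (auto simp: charts_at_def)
  then show ?thesis
    by (simp add: transition_deriv_def frechet_derivative_works)
qed

lemma transition_deriv_zero: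
  assumes "c \<in> charts_at A x" "d \<in> charts_at A x"
  shows "transition_deriv c d x 0 = 0"
  using transition_has_derivative[OF assms] has_derivative_linear linear_0 by blast

lemma transition_deriv_self:
  assumes "c \<in> charts_at A x"
  shows "transition_deriv c c x v = v"
proof -
  have c: "c \<in> A" "x \<in> fst c"
    using assms by (auto simp: charts_at_def)
  have "((\<lambda>u. u) has_derivative transition_deriv c c x) (at (snd c x))"
    using transition_has_derivative[OF assms assms] chart_image_open[OF c(1)]
    by (rule has_derivative_transform_within_open) (use c in \<open>auto simp: transition_apply\<close>)
  then show ?thesis
    using has_derivative_unique[OF has_derivative_ident] by metis
qed

text \<open>The cocycle identity \<open>\<tau>\<^sub>d\<^sub>e \<circ> \<tau>\<^sub>c\<^sub>d = \<tau>\<^sub>c\<^sub>e\<close> of the transition maps holds near \<open>x\<close>, on the common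
  domain of the three charts; differentiating it gives this one.\<close>

lemma transition_deriv_cocycle:
  assumes "c \<in> charts_at A x" "d \<in> charts_at A x" "e \<in> charts_at A x"
  shows "transition_deriv d e x (transition_deriv c d x v) = transition_deriv c e x v"
proof -
  have ch: "c \<in> A" "d \<in> A" "e \<in> A" "x \<in> fst c" "x \<in> fst d" "x \<in> fst e"
    using assms by (auto simp: charts_at_def)
  let ?S = "snd c ` (fst c \<inter> fst d \<inter> fst e)"
  have S: "open ?S"
    using ch by (intro chart_image_open_subset openin_Int chart_domain_open) auto
  have "(transition d e has_derivative transition_deriv d e x) (at (transition c d (snd c x)))"
    using transition_has_derivative[OF assms(2,3)] ch by (simp add: transition_apply)
  from diff_chain_at[OF transition_has_derivative[OF assms(1,2)] this]
  have "(transition c e has_derivative (transition_deriv d e x \<circ> transition_deriv c d x))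
      (at (snd c x))"
    using S by (rule has_derivative_transform_within_open) (use ch in \<open>auto simp: transition_apply\<close>)
  then have "transition_deriv d e x \<circ> transition_deriv c d x = transition_deriv c e x"
    using has_derivative_unique transition_has_derivative[OF assms(1,3)] by blast
  then show ?thesis
    by (metis comp_apply)
qed

lemma tangent_of_coords_in_tangent_space:
  assumes "c \<in> charts_at A x"
  shows "tangent_of_coords A c x v \<in> tangent_space A x"
  using assms by (auto simp: tangent_space_def tangent_of_coords_def transition_deriv_cocycle)

lemma zero_in_tangent_space: "(\<lambda>_. 0) \<in> tangent_space A x"
  by (simp add: tangent_space_def transition_deriv_zero)

lemma tangent_eq_zero:
  assumes "\<xi> \<in> tangent_space A x" "c \<in> charts_at A x" "\<xi> c = 0"
  shows "\<xi> = (\<lambda>_. 0)"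
proof
  fix d show "\<xi> d = 0"
  proof (cases "d \<in> charts_at A x")
    case True
    then have "\<xi> d = transition_deriv c d x (\<xi> c)"
      using assms(1,2) unfolding tangent_space_def by blast
    then show ?thesis
      using transition_deriv_zero[OF assms(2) True] assms(3) by simp
  next
    case False
    then show ?thesis
      using assms(1) unfolding tangent_space_def by blast
  qed
qed

lemma charts_at_nonempty: "x \<in> topspace X \<Longrightarrow> charts_at A x \<noteq> {}"
  unfolding charts_at_def using charts_cover by blast

lemma chart_at_in_charts_at: "x \<in> topspace X \<Longrightarrow> chart_at A x \<in> charts_at A x"
  unfolding chart_at_def using charts_at_nonempty some_in_eq by blast

lemma charts_at_topspace: "c \<in> charts_at A x \<Longrightarrow> x \<in> topspace X"
  unfolding charts_at_def using charts_cover by blast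

lemma slit_tangent_bundle_over:
  assumes "x \<in> topspace X"
  obtains y where "(x, y) \<in> slit_tangent_bundle X A"
proof -
  let ?c = "chart_at A x"
  let ?y = "tangent_of_coords A ?c x (axis undefined 1)"
  have c: "?c \<in> charts_at A x"
    by (rule chart_at_in_charts_at[OF assms])
  have "?y ?c \<noteq> 0"
    using c by (simp add: tangent_of_coords_def transition_deriv_self axis_eq_0_iff)
  then have "?y \<noteq> (\<lambda>_. 0)"
    by metis
  then show ?thesis
    using that tangent_of_coords_in_tangent_space[OF c] assms
    by (auto simp: slit_tangent_bundle_def)
qed

text \<open>The local representative of \<open>f\<close> is known to be constant only on the chart image, since
  \<open>inv_into\<close> is arbitrary elsewhere; openness of the image makes this enough.\<close>

lemma coord_deriv_const:
  assumes "\<forall>x \<in> topspace X. f x = r" "c \<in> charts_at A x"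
  shows "coord_deriv f c x i = 0"
proof -
  have c: "c \<in> A" "x \<in> fst c" "fst c \<subseteq> topspace X"
    using assms(2) charts_cover by (auto simp: charts_at_def)
  have "((\<lambda>_. r) has_derivative (\<lambda>_. 0)) (at (snd c x))"
    by simp
  then have "((f \<circ> inv_into (fst c) (snd c)) has_derivative (\<lambda>_. 0)) (at (snd c x))"
    using chart_image_open[OF c(1)]
    by (rule has_derivative_transform_within_open) (use c assms(1) in auto)
  then have "frechet_derivative (f \<circ> inv_into (fst c) (snd c)) (at (snd c x)) = (\<lambda>_. 0)"
    by (rule frechet_derivative_at[symmetric])
  then show ?thesis
    by (simp add: coord_deriv_def partial_deriv_def)
qed

end

section \<open>The gradient of a function with vanishing differential\<close>

lemma (in finsler_manifold) fundamental_form_pos: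
  assumes "(x, y) \<in> slit_tangent_bundle X A" "\<eta> \<in> tangent_space A x" "\<eta> \<noteq> (\<lambda>_. 0)"
  shows "0 < fundamental_form A F x y \<eta> \<eta>"
proof -
  let ?c = "chart_at A x"
  have c: "?c \<in> charts_at A x"
    using assms(1) by (auto simp: slit_tangent_bundle_def intro: chart_at_in_charts_at)
  then have "\<eta> ?c \<noteq> 0"
    using assms tangent_eq_zero by blast
  then have "0 < \<eta> ?c \<bullet> (hessian_matrix A F ?c x y *v \<eta> ?c)"
    using hessian_positive_definite[OF assms(1) c] unfolding positive_definite_def by blast
  also have "\<dots> = fundamental_form A F x y \<eta> \<eta>"
    by (simp add: fundamental_form_def Let_def inner_vec_def matrix_vector_mult_def
        sum_distrib_left mult_ac)
  finally show ?thesis .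
qed

lemma fundamental_form_zero [simp]: "fundamental_form A F x y (\<lambda>_. 0) \<xi> = 0"
  by (simp add: fundamental_form_def Let_def)

text \<open>The gradient is a definite description, so this also says that the description is
  meaningful here: testing the defining equation with \<open>\<xi> = \<eta>\<close> excludes any nonzero \<open>\<eta>\<close>.\<close>

lemma (in finsler_manifold) gradient_eq_zero:
  assumes "(x, y) \<in> slit_tangent_bundle X A"
    and "\<And>c i. c \<in> charts_at A x \<Longrightarrow> coord_deriv f c x i = 0"
  shows "gradient A F f x y = (\<lambda>_. 0)"
proof -
  have "chart_at A x \<in> charts_at A x"
    using assms(1) by (auto simp: slit_tangent_bundle_def intro: chart_at_in_charts_at)
  then have "differential A f x \<xi> = 0" for \<xi>
    by (simp add: differential_def Let_def assms(2))
  then show ?thesis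
    unfolding gradient_def using zero_in_tangent_space fundamental_form_pos[OF assms(1)]
    by (intro the_equality) (auto, fastforce)
qed

section \<open>Symmetry of the associated matrix\<close>

lemma convolution_metric_imp_critical:
  fixes A1 :: "('a, 'm::finite) chart set" and A2 :: "('b, 'n::finite) chart set"
  assumes "smooth_manifold X1 A1" "smooth_manifold X2 A2"
    and "\<forall>x \<in> topspace X1. 0 < f1 x" "\<forall>x \<in> topspace X2. 0 < f2 x"
    and "is_convolution_metric X1 A1 F1 f1 X2 A2 F2 f2"
  shows "(\<forall>x c i. c \<in> charts_at A1 x \<longrightarrow> coord_deriv f1 c x i = 0) \<or>
         (\<forall>x c i. c \<in> charts_at A2 x \<longrightarrow> coord_deriv f2 c x i = 0)"
proof -
  interpret M1: smooth_manifold X1 A1 by fact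
  interpret M2: smooth_manifold X2 A2 by fact
  have "coord_deriv f1 c1 x1 i * coord_deriv f2 c2 x2 j = 0"
    if c1: "c1 \<in> charts_at A1 x1" and c2: "c2 \<in> charts_at A2 x2" for x1 c1 i x2 c2 j
  proof -
    have x: "x1 \<in> topspace X1" "x2 \<in> topspace X2"
      using M1.charts_at_topspace[OF c1] M2.charts_at_topspace[OF c2] by auto
    obtain y1 where y1: "(x1, y1) \<in> slit_tangent_bundle X1 A1"
      using M1.slit_tangent_bundle_over[OF x(1)] by blast
    obtain y2 where y2: "(x2, y2) \<in> slit_tangent_bundle X2 A2"
      using M2.slit_tangent_bundle_over[OF x(2)] by blast
    let ?G = "associated_matrix A1 F1 f1 A2 F2 f2 c1 c2 (x1, x2) (y1, y2)"
    have "((x1, x2), (y1, y2)) \<in> product_slit_tangent_bundle X1 A1 X2 A2"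
      using y1 y2 by (simp add: product_slit_tangent_bundle_def)
    then have "transpose ?G = ?G"
      using assms(5) c1 c2 unfolding is_convolution_metric_def Let_def by blast
    then have "?G $ Inl i $ Inr j = transpose ?G $ Inl i $ Inr j"
      by (rule arg_cong[where f = "\<lambda>M. M $ Inl i $ Inr j", OF sym])
    also have "\<dots> = ?G $ Inr j $ Inl i"
      unfolding transpose_def by (simp only: vec_lambda_beta)
    finally have "2 * f1 x1 * f2 x2 * (coord_deriv f1 c1 x1 i * coord_deriv f2 c2 x2 j) = 0"
      by simp
    moreover have "0 < f1 x1" "0 < f2 x2"
      using x assms(3,4) by blast+
    ultimately show ?thesis
      by simp
  qed
  then show ?thesis
    by (metis mult_eq_0_iff)
qed

theorem proposition1p2:
  fixes X1 :: "'a topology" and A1 :: "('a, 'm::finite) chart set"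
    and F1 :: "'a \<Rightarrow> ('a, 'm) tangent \<Rightarrow> real" and f1 :: "'a \<Rightarrow> real"
    and X2 :: "'b topology" and A2 :: "('b, 'n::finite) chart set"
    and F2 :: "'b \<Rightarrow> ('b, 'n) tangent \<Rightarrow> real" and f2 :: "'b \<Rightarrow> real"
  assumes "finsler_manifold X1 A1 F1"
    and "finsler_manifold X2 A2 F2"
    and "smooth_function A1 f1" and "\<forall>x \<in> topspace X1. 0 < f1 x"
    and "smooth_function A2 f2" and "\<forall>x \<in> topspace X2. 0 < f2 x"
    and "is_convolution_metric X1 A1 F1 f1 X2 A2 F2 f2"
  shows "(((\<forall>((x1, x2), (y1, y2)) \<in> product_slit_tangent_bundle X1 A1 X2 A2.
             \<forall>(\<xi>1, \<xi>2) \<in> tangent_space A1 x1 \<times> tangent_space A2 x2.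
               fundamental_form A1 F1 x1 y1 (gradient A1 F1 f1 x1 y1) \<xi>1 = 0)
          \<or> (\<forall>((x1, x2), (y1, y2)) \<in> product_slit_tangent_bundle X1 A1 X2 A2.
             \<forall>(\<xi>1, \<xi>2) \<in> tangent_space A1 x1 \<times> tangent_space A2 x2.
               fundamental_form A2 F2 x2 y2 (gradient A2 F2 f2 x2 y2) \<xi>2 = 0))
         \<or> ((\<exists>r. r \<noteq> 0 \<and> (\<forall>x \<in> topspace X1. f1 x = r))
          \<or> (\<exists>r. r \<noteq> 0 \<and> (\<forall>x \<in> topspace X2. f2 x = r))))
       \<and> ((\<forall>x \<in> topspace X1. f1 x = 1) \<longrightarrow>
            (\<forall>(x, y) \<in> product_slit_tangent_bundle X1 A1 X2 A2.
               convolution A1 F1 f1 A2 F2 f2 x y = warped_product_fst F1 F2 f2 x y))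
       \<and> ((\<forall>x \<in> topspace X2. f2 x = 1) \<longrightarrow>
            (\<forall>(x, y) \<in> product_slit_tangent_bundle X1 A1 X2 A2.
               convolution A1 F1 f1 A2 F2 f2 x y = warped_product_snd F1 f1 F2 x y))"
proof -
  interpret M1: finsler_manifold X1 A1 F1 by fact
  interpret M2: finsler_manifold X2 A2 F2 by fact
  have "(\<forall>x c i. c \<in> charts_at A1 x \<longrightarrow> coord_deriv f1 c x i = 0) \<or>
        (\<forall>x c i. c \<in> charts_at A2 x \<longrightarrow> coord_deriv f2 c x i = 0)"
    using M1.smooth_manifold_axioms M2.smooth_manifold_axioms assms(4,6,7)
    by (rule convolution_metric_imp_critical)
  then have grad:
    "(\<forall>x y. (x, y) \<in> slit_tangent_bundle X1 A1 \<longrightarrow> gradient A1 F1 f1 x y = (\<lambda>_. 0)) \<or>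
     (\<forall>x y. (x, y) \<in> slit_tangent_bundle X2 A2 \<longrightarrow> gradient A2 F2 f2 x y = (\<lambda>_. 0))"
    using M1.gradient_eq_zero[where f = f1] M2.gradient_eq_zero[where f = f2] by blast
  have warped_fst: "convolution A1 F1 f1 A2 F2 f2 (x1, x2) (y1, y2)
      = warped_product_fst F1 F2 f2 (x1, x2) (y1, y2)"
    if "\<forall>x \<in> topspace X1. f1 x = 1" "(x1, y1) \<in> slit_tangent_bundle X1 A1" for x1 x2 y1 y2
  proof -
    have "gradient A1 F1 f1 x1 y1 = (\<lambda>_. 0)"
      using that(2) M1.coord_deriv_const[OF that(1)] by (rule M1.gradient_eq_zero)
    then show ?thesis
      using that by (simp add: Let_def slit_tangent_bundle_def)
  qed
  have warped_snd: "convolution A1 F1 f1 A2 F2 f2 (x1, x2) (y1, y2)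
      = warped_product_snd F1 f1 F2 (x1, x2) (y1, y2)"
    if "\<forall>x \<in> topspace X2. f2 x = 1" "(x2, y2) \<in> slit_tangent_bundle X2 A2" for x1 x2 y1 y2
  proof -
    have "gradient A2 F2 f2 x2 y2 = (\<lambda>_. 0)"
      using that(2) M2.coord_deriv_const[OF that(1)] by (rule M2.gradient_eq_zero)
    then show ?thesis
      using that by (simp add: Let_def slit_tangent_bundle_def)
  qed
  show ?thesis
    using grad warped_fst warped_snd
    by (auto simp: product_slit_tangent_bundle_def simp del: convolution.simps
        warped_product_fst.simps warped_product_snd.simps)
qed

end
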